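(* Let $A\in C([0,T),\mathbb R^{d\times d})$, let $\Phi(t,\tau)$, $t,\tau\in[0,T)$, be the solution operator of $\dot u(t)=A(t)u(t)$, and for $V_0\in\mathcal G(s,d)$ set $V(t)=\Phi(t,0)V_0$. Then for every $\tau\in[0,T)$ $$\frac{d}{dt}\angle(V(\tau),V(t))\Big|_{t=\tau+}=\big\|(I_d-P_{V(\tau)})A(\tau)P_{V(\tau)}\big\|,$$ where $\|\cdot\|$ is the spectral norm on $\mathbb R^{d\times d}$ and $P_{V(\tau)}$ is the orthogonal projection onto $V(\tau)$ (the right derivative exists).
   Context: $\mathcal G(s,d)$ is the Grassmannian of $s$-dimensional subspaces of $\mathbb R^d$. For $V,W\in\mathcal G(s,d)$ choose $P,Q\in\mathbb R^{d\times s}$ with orthonormal columns spanning $V$ and $W$; the principal angles $0\le\phi_1\le\dots\le\phi_s\le\pi/2$ are defined by $\cos\phi_j=\sigma_j$ where $\sigma_1\ge\dots\ge\sigma_s\ge0$ are the singular values of $P^\top Q$, and $\angle(V,W):=\phi_s$. The solution operator satisfies $\partial_t\Phi(t,\tau)=A(t)\Phi(t,\tau)$, $\Phi(\tau,\tau)=I_d$. *)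

theory Defs
  imports "HOL-Analysis.Analysis" "HOL-Library.Extended_Real"
begin

text \<open>Time domain [0,T) with T possibly infinite.\<close>
definition time_dom :: "ereal \<Rightarrow> real set" where
  "time_dom T = {t. 0 \<le> t \<and> ereal t < T}"

text \<open>Grassmannian G(s,d) of s-dimensional linear subspaces of R^d.\<close>
definition grassmannian :: "nat \<Rightarrow> (real^'n) set set" where
  "grassmannian s = {V. subspace V \<and> dim V = s}"

text \<open>p_0,...,p_{s-1} are orthonormal and span V (the columns of P).\<close>
definition is_onb :: "(real^'n) set \<Rightarrow> nat \<Rightarrow> (nat \<Rightarrow> real^'n) \<Rightarrow> bool" where
  "is_onb V s p \<longleftrightarrow> (\<forall>i<s. \<forall>j<s. p i \<bullet> p j = (if i = j then 1 else 0))
                    \<and> span (p ` {..<s}) = V"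

text \<open>Eigenvalue of an s x s matrix given as nat-indexed entries.\<close>
definition is_eigenvalue_sq :: "nat \<Rightarrow> (nat \<Rightarrow> nat \<Rightarrow> real) \<Rightarrow> real \<Rightarrow> bool" where
  "is_eigenvalue_sq s B c \<longleftrightarrow>
     (\<exists>x::nat \<Rightarrow> real. (\<exists>i<s. x i \<noteq> 0) \<and> (\<forall>i<s. (\<Sum>j<s. B i j * x j) = c * x i))"

text \<open>Smallest singular value sigma_s of an s x s matrix M: square root of the
  smallest eigenvalue of M^T M.\<close>
definition min_singular_value :: "nat \<Rightarrow> (nat \<Rightarrow> nat \<Rightarrow> real) \<Rightarrow> real" where
  "min_singular_value s M =
     sqrt (Min {c. is_eigenvalue_sq s (\<lambda>i j. \<Sum>k<s. M k i * M k j) c})"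

text \<open>Largest principal angle phi_s between V and W (s = dim V):
  cos phi_s = sigma_s(P^T Q) for orthonormal bases P of V and Q of W.\<close>
definition subspace_angle :: "(real^'n) set \<Rightarrow> (real^'n) set \<Rightarrow> real" where
  "subspace_angle V W =
     (let s = dim V;
          p = (SOME p. is_onb V s p);
          q = (SOME q. is_onb W s q)
      in arccos (min_singular_value s (\<lambda>i j. p i \<bullet> q j)))"

text \<open>Orthogonal projection onto a subspace, and its matrix.\<close>
definition orth_proj :: "(real^'n) set \<Rightarrow> real^'n \<Rightarrow> real^'n" where
  "orth_proj V x = (THE y. y \<in> V \<and> (\<forall>w\<in>V. (x - y) \<bullet> w = 0))"

definition proj_matrix :: "(real^'n) set \<Rightarrow> real^'n^'n" where
  "proj_matrix V = matrix (orth_proj V)"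

text \<open>Spectral norm (operator norm induced by the Euclidean norm).\<close>
definition spectral_norm :: "real^'n^'n \<Rightarrow> real" where
  "spectral_norm M = onorm (\<lambda>x. M *v x)"

end

theory Submission
  imports Defs
begin

text \<open>Write \<open>V = V(\<tau>)\<close> and \<open>M(t) = \<Phi>(t,0) \<Phi>(\<tau>,0)\<^sup>-\<^sup>1\<close> (a Gronwall argument shows that \<open>\<Phi>(\<tau>,0)\<close>
  is invertible); then \<open>V(t) = M(t) V\<close> and \<open>M(t) = I + (t - \<tau>) A(\<tau>) + o(t - \<tau>)\<close>. The sine of the largest
  principal angle \<open>\<angle>(V, W)\<close> is the largest distance \<open>\<parallel>w - P\<^sub>V w\<parallel>\<close> of a unit vector \<open>w \<in> W\<close> from \<open>V\<close>,
  because a unit vector minimising \<open>\<parallel>P\<^sub>V w\<parallel>\<close> is an eigenvector of \<open>(P\<^sup>T Q)\<^sup>T (P\<^sup>T Q)\<close> for its least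
  eigenvalue. For \<open>w = M(t) v\<close> with \<open>v \<in> V\<close> we have
  \<open>w - P\<^sub>V w = (t - \<tau>) (I - P\<^sub>V) A(\<tau>) v + o(t - \<tau>) \<parallel>v\<parallel>\<close>, and maximising over \<open>v\<close> squeezes
  \<open>sin \<angle>(V, V(t)) / (t - \<tau>)\<close> between two quantities tending to \<open>\<parallel>(I - P\<^sub>V) A(\<tau>) P\<^sub>V\<parallel>\<close>. Finally,
  \<open>arcsin\<close> has derivative \<open>1\<close> at \<open>0\<close>.\<close>

section \<open>Matrix norms and the time domain\<close>

lemma norm_matrix_vector_le_spectral_norm: "norm (M *v x) \<le> spectral_norm M * norm x"
  unfolding spectral_norm_def by (rule onorm) simp

lemma spectral_norm_nonneg: "0 \<le> spectral_norm M"
  unfolding spectral_norm_def by (rule onorm_pos_le) simp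

lemma spectral_norm_le_norm: "spectral_norm M \<le> real CARD('n) * real CARD('n) * norm M"
  for M :: "real^'n^'n"
  unfolding spectral_norm_def
proof (rule onorm_le_matrix_component)
  fix i j
  have "\<bar>M$i$j\<bar> \<le> norm (M$i)" by (rule component_le_norm_cart)
  also have "\<dots> \<le> norm M" by (rule Finite_Cartesian_Product.norm_nth_le)
  finally show "\<bar>M$i$j\<bar> \<le> norm M" .
qed

lemma compact_spectral_norm_bounded:
  fixes A :: "real \<Rightarrow> real^'n^'n"
  assumes "compact S" "continuous_on S A"
  obtains K where "\<And>r. r \<in> S \<Longrightarrow> spectral_norm (A r) \<le> K"
proof -
  have "compact (A ` S)" by (rule compact_continuous_image[OF assms(2,1)])
  then obtain M where M: "\<And>r. r \<in> S \<Longrightarrow> norm (A r) \<le> M"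
    using compact_imp_bounded bounded_iff by (metis image_eqI)
  have "spectral_norm (A r) \<le> real CARD('n) * real CARD('n) * M" if "r \<in> S" for r
  proof -
    have "spectral_norm (A r) \<le> real CARD('n) * real CARD('n) * norm (A r)"
      by (rule spectral_norm_le_norm)
    also have "\<dots> \<le> real CARD('n) * real CARD('n) * M"
      using M[OF that] by (rule mult_left_mono) simp
    finally show ?thesis .
  qed
  then show thesis using that by blast
qed

lemma bounded_linear_matrix_vector_mult_left: "bounded_linear (\<lambda>A::real^'n^'m. A *v x)"
  by (rule linear_conv_bounded_linear[THEN iffD1], rule linearI)
    (simp_all add: matrix_vector_mult_add_rdistrib scaleR_matrix_vector_assoc)

lemma bounded_linear_matrix_mult_right: "bounded_linear (\<lambda>A::real^'n^'m. A ** C)"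
  by (rule linear_conv_bounded_linear[THEN iffD1], rule linearI)
    (vector matrix_matrix_mult_def sum.distrib[symmetric] field_simps, simp add: scalar_matrix_assoc)

lemma atLeastAtMost_subset_time_dom: "t \<in> time_dom T \<Longrightarrow> {0..t} \<subseteq> time_dom T"
  unfolding time_dom_def by (auto intro: le_less_trans[of _ "ereal t"])

lemma time_dom_right_neighbourhood:
  assumes "\<tau> \<in> time_dom T"
  obtains b where "\<tau> < b" "{\<tau>..b} \<subseteq> time_dom T"
proof -
  obtain b where "\<tau> < b" "ereal b < T"
    using assms ereal_dense2[of "ereal \<tau>" T] by (auto simp: time_dom_def)
  then have "{\<tau>..b} \<subseteq> time_dom T"
    using assms by (auto simp: time_dom_def intro: le_less_trans[of _ "ereal b"])
  then show thesis using that \<open>\<tau> < b\<close> by blast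
qed

lemma eventually_at_right_time_dom:
  assumes "\<tau> \<in> time_dom T"
  shows "\<forall>\<^sub>F t in at_right \<tau>. t \<in> time_dom T"
proof -
  obtain b where "\<tau> < b" "{\<tau>..b} \<subseteq> time_dom T" using time_dom_right_neighbourhood[OF assms] .
  then show ?thesis unfolding eventually_at_right_field by (intro exI[of _ b]) auto
qed

lemma has_vector_derivative_at_right_time_dom:
  assumes "(f has_vector_derivative f') (at \<tau> within time_dom T)" "\<tau> \<in> time_dom T"
  shows "(f has_vector_derivative f') (at_right \<tau>)"
proof -
  obtain b where "\<tau> < b" "{\<tau>..b} \<subseteq> time_dom T" using time_dom_right_neighbourhood[OF assms(2)] .
  then show ?thesis
    using has_vector_derivative_within_subset[OF assms(1)] at_within_Icc_at_right[OF \<open>\<tau> < b\<close>] by metis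
qed

section \<open>Linear ODEs\<close>

text \<open>With \<open>K\<close> bounding \<open>A\<close> on \<open>[a, b]\<close>, the function \<open>\<parallel>u r\<parallel>\<^sup>2 e\<^sup>2\<^sup>K\<^sup>r\<close> is nondecreasing.\<close>
lemma linear_ode_vanishing_backward:
  fixes A :: "real \<Rightarrow> real^'n^'n" and u :: "real \<Rightarrow> real^'n"
  assumes "a \<le> b" and A: "continuous_on {a..b} A"
    and u: "\<And>r. r \<in> {a..b} \<Longrightarrow> (u has_vector_derivative A r *v u r) (at r within {a..b})"
    and "u b = 0"
  shows "u a = 0"
proof -
  obtain K where K: "\<And>r. r \<in> {a..b} \<Longrightarrow> spectral_norm (A r) \<le> K"
    using compact_spectral_norm_bounded[OF compact_Icc A] by blast
  define g where "g r = (u r \<bullet> u r) * exp (2 * K * r)" for r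
  define g' where "g' r = (2 * (u r \<bullet> (A r *v u r)) + 2 * K * (u r \<bullet> u r)) * exp (2 * K * r)" for r
  have g': "(g has_real_derivative g' r) (at r within {a..b})" if "r \<in> {a..b}" for r
  proof -
    have "((\<lambda>r. u r \<bullet> u r) has_derivative (\<lambda>h. u r \<bullet> (h *\<^sub>R (A r *v u r)) + (h *\<^sub>R (A r *v u r)) \<bullet> u r))
        (at r within {a..b})"
      using u[OF that] unfolding has_vector_derivative_def by (intro has_derivative_inner)
    moreover have "(\<lambda>h. u r \<bullet> (h *\<^sub>R (A r *v u r)) + (h *\<^sub>R (A r *v u r)) \<bullet> u r) = (*) (2 * (u r \<bullet> (A r *v u r)))"
      by (auto simp: fun_eq_iff inner_commute)
    ultimately have "((\<lambda>r. u r \<bullet> u r) has_real_derivative 2 * (u r \<bullet> (A r *v u r))) (at r within {a..b})"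
      by (simp add: has_field_derivative_def)
    moreover have "((\<lambda>r. exp (2 * K * r)) has_real_derivative exp (2 * K * r) * (2 * K)) (at r within {a..b})"
      by (intro derivative_eq_intros) auto
    ultimately show ?thesis
      unfolding g_def g'_def by (rule DERIV_cong[OF DERIV_mult]) (simp add: algebra_simps)
  qed
  have g'_nonneg: "0 \<le> g' r" if "r \<in> {a..b}" for r
  proof -
    have "- (u r \<bullet> (A r *v u r)) \<le> norm (u r) * norm (A r *v u r)"
      by (metis Cauchy_Schwarz_ineq2 abs_le_D2)
    also have "\<dots> \<le> norm (u r) * (K * norm (u r))"
    proof (rule mult_left_mono[OF order_trans[OF norm_matrix_vector_le_spectral_norm]])
      show "spectral_norm (A r) * norm (u r) \<le> K * norm (u r)"
        using K[OF that] by (rule mult_right_mono) simp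
    qed simp
    finally have "0 \<le> 2 * (u r \<bullet> (A r *v u r)) + 2 * K * (u r \<bullet> u r)"
      by (simp add: dot_square_norm power2_eq_square algebra_simps)
    then show ?thesis
      unfolding g'_def by simp
  qed
  have "g a \<le> g b"
  proof (rule DERIV_nonneg_imp_increasing_open[OF \<open>a \<le> b\<close>])
    fix r assume "a < r" "r < b"
    then show "\<exists>y. DERIV g r :> y \<and> 0 \<le> y"
      using g'[of r] g'_nonneg[of r] at_within_Icc_at[of a r b] by auto
  next
    show "continuous_on {a..b} g"
      unfolding continuous_on_eq_continuous_within using g' DERIV_continuous by blast
  qed
  then have "(u a \<bullet> u a) * exp (2 * K * a) \<le> 0" using \<open>u b = 0\<close> by (simp add: g_def)
  then have "u a \<bullet> u a \<le> 0" by (simp add: mult_le_0_iff)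
  then show "u a = 0" using inner_ge_zero[of "u a"] by simp
qed

lemma fundamental_matrix_injective:
  fixes A U :: "real \<Rightarrow> real^'n^'n"
  assumes A: "continuous_on (time_dom T) A"
    and U: "\<And>t. t \<in> time_dom T \<Longrightarrow> (U has_vector_derivative (A t ** U t)) (at t within time_dom T)"
    and "U 0 = mat 1" and t: "t \<in> time_dom T"
  shows "inj ((*v) (U t))"
proof (rule injI)
  fix x y assume "U t *v x = U t *v y"
  have sub: "{0..t} \<subseteq> time_dom T" using t by (rule atLeastAtMost_subset_time_dom)
  have "(\<lambda>r. U r *v (x - y)) 0 = 0"
  proof (rule linear_ode_vanishing_backward[where b = t])
    show "0 \<le> t" using t by (simp add: time_dom_def)
    show "continuous_on {0..t} A" using A sub by (rule continuous_on_subset)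
    show "U t *v (x - y) = 0"
      using \<open>U t *v x = U t *v y\<close> by (simp add: matrix_vector_mult_diff_distrib)
    fix r assume "r \<in> {0..t}"
    then have "(U has_vector_derivative (A r ** U r)) (at r within {0..t})"
      using U sub by (blast intro: has_vector_derivative_within_subset)
    then have "((\<lambda>r. U r *v (x - y)) has_vector_derivative (A r ** U r) *v (x - y)) (at r within {0..t})"
      by (rule bounded_linear.has_vector_derivative[OF bounded_linear_matrix_vector_mult_left])
    then show "((\<lambda>r. U r *v (x - y)) has_vector_derivative A r *v (U r *v (x - y))) (at r within {0..t})"
      by (simp add: matrix_vector_mul_assoc)
  qed
  then show "x = y" using \<open>U 0 = mat 1\<close> by simp
qed

lemma fundamental_matrix_relative:
  fixes A U :: "real \<Rightarrow> real^'n^'n"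
  assumes A: "continuous_on (time_dom T) A"
    and U: "\<And>t. t \<in> time_dom T \<Longrightarrow> (U has_vector_derivative (A t ** U t)) (at t within time_dom T)"
    and "U 0 = mat 1" and \<tau>: "\<tau> \<in> time_dom T"
  obtains M where "M \<tau> = mat 1" "(M has_vector_derivative A \<tau>) (at_right \<tau>)"
    and "\<And>t X. (*v) (M t) ` (*v) (U \<tau>) ` X = (*v) (U t) ` X"
proof -
  obtain Li where "Li ** U \<tau> = mat 1"
    using fundamental_matrix_injective[OF A U \<open>U 0 = mat 1\<close> \<tau>] matrix_left_invertible_ker[of "U \<tau>"]
    by (metis inj_eq matrix_vector_mult_0_right)
  then have "U \<tau> ** Li = mat 1" by (simp add: matrix_left_right_inverse)
  have "(U has_vector_derivative A \<tau> ** U \<tau>) (at_right \<tau>)"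
    using U[OF \<tau>] \<tau> by (rule has_vector_derivative_at_right_time_dom)
  then have "((\<lambda>t. U t ** Li) has_vector_derivative A \<tau> ** U \<tau> ** Li) (at_right \<tau>)"
    by (rule bounded_linear.has_vector_derivative[OF bounded_linear_matrix_mult_right])
  then have "((\<lambda>t. U t ** Li) has_vector_derivative A \<tau>) (at_right \<tau>)"
    by (simp add: matrix_mul_assoc[symmetric] \<open>U \<tau> ** Li = mat 1\<close>)
  moreover have "(*v) (U t ** Li) ` (*v) (U \<tau>) ` X = (*v) (U t) ` X" for t X
    by (simp add: image_image matrix_vector_mul_assoc matrix_mul_assoc[symmetric] \<open>Li ** U \<tau> = mat 1\<close>)
  ultimately show thesis using that[of "\<lambda>t. U t ** Li"] \<open>U \<tau> ** Li = mat 1\<close> by blast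
qed

section \<open>Orthogonal projections and orthonormal bases\<close>

lemma orth_proj_eqI:
  fixes V :: "(real^'n) set"
  assumes V: "subspace V" and "y \<in> V" and orth: "\<And>w. w \<in> V \<Longrightarrow> (x - y) \<bullet> w = 0"
  shows "orth_proj V x = y"
  unfolding orth_proj_def
proof (rule the_equality)
  fix y' assume y': "y' \<in> V \<and> (\<forall>w\<in>V. (x - y') \<bullet> w = 0)"
  have "y' - y \<in> V" using \<open>y \<in> V\<close> y' V by (simp add: subspace_diff)
  have "(y' - y) \<bullet> (y' - y) = (x - y) \<bullet> (y' - y) - (x - y') \<bullet> (y' - y)"
    by (simp add: algebra_simps)
  also have "\<dots> = 0" using orth y' \<open>y' - y \<in> V\<close> by simp
  finally show "y' = y" by simp
qed (use assms in auto)

lemma orth_proj_in: "subspace V \<Longrightarrow> orth_proj V x \<in> V"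
  and orth_proj_orthogonal: "subspace V \<Longrightarrow> w \<in> V \<Longrightarrow> (x - orth_proj V x) \<bullet> w = 0"
  for V :: "(real^'n) set"
proof -
  assume V: "subspace V"
  obtain y z where "y \<in> span V" "\<And>w. w \<in> span V \<Longrightarrow> orthogonal z w" "x = y + z"
    using orthogonal_subspace_decomp_exists[of V x] by blast
  moreover have "span V = V" using V by (simp add: span_eq_iff)
  ultimately have y: "y \<in> V" "\<And>w. w \<in> V \<Longrightarrow> (x - y) \<bullet> w = 0"
    by (auto simp: orthogonal_def)
  have "orth_proj V x = y" by (rule orth_proj_eqI[OF V y])
  then show "orth_proj V x \<in> V" using y by simp
  assume "w \<in> V" then show "(x - orth_proj V x) \<bullet> w = 0" using y \<open>orth_proj V x = y\<close> by simp
qed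

lemma orth_proj_id: "subspace V \<Longrightarrow> v \<in> V \<Longrightarrow> orth_proj V v = v"
  for V :: "(real^'n) set"
  by (rule orth_proj_eqI) auto

lemma linear_orth_proj:
  fixes V :: "(real^'n) set"
  assumes V: "subspace V"
  shows "linear (orth_proj V)"
proof (rule linearI)
  fix x y :: "real^'n" and c :: real
  show "orth_proj V (x + y) = orth_proj V x + orth_proj V y"
  proof (rule orth_proj_eqI[OF V])
    show "orth_proj V x + orth_proj V y \<in> V"
      by (intro subspace_add[OF V] orth_proj_in[OF V])
    fix w assume "w \<in> V"
    then show "(x + y - (orth_proj V x + orth_proj V y)) \<bullet> w = 0"
      using orth_proj_orthogonal[OF V, of w x] orth_proj_orthogonal[OF V, of w y]
      by (simp add: algebra_simps inner_diff_left inner_add_left)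
  qed
  show "orth_proj V (c *\<^sub>R x) = c *\<^sub>R orth_proj V x"
  proof (rule orth_proj_eqI[OF V])
    show "c *\<^sub>R orth_proj V x \<in> V" using V orth_proj_in subspace_scale by blast
    fix w assume "w \<in> V"
    then show "(c *\<^sub>R x - c *\<^sub>R orth_proj V x) \<bullet> w = 0"
      using orth_proj_orthogonal[OF V, of w x] by (simp flip: scaleR_diff_right)
  qed
qed

lemma inner_orth_proj_left:
  fixes V :: "(real^'n) set"
  assumes "subspace V"
  shows "orth_proj V x \<bullet> y = orth_proj V x \<bullet> orth_proj V y"
proof -
  have "(y - orth_proj V y) \<bullet> orth_proj V x = 0"
    by (intro orth_proj_orthogonal orth_proj_in assms)
  then have "orth_proj V x \<bullet> y - orth_proj V x \<bullet> orth_proj V y = 0"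
    by (simp only: inner_commute[of _ "orth_proj V x"] inner_diff_right)
  then show ?thesis by simp
qed

lemma norm_orth_proj_pythagoras:
  fixes V :: "(real^'n) set"
  assumes "subspace V"
  shows "(norm x)\<^sup>2 = (norm (orth_proj V x))\<^sup>2 + (norm (x - orth_proj V x))\<^sup>2"
proof -
  have "orthogonal (orth_proj V x) (x - orth_proj V x)"
    using orth_proj_orthogonal[OF assms orth_proj_in[OF assms]] by (simp add: orthogonal_def inner_commute)
  then show ?thesis using norm_add_Pythagorean by fastforce
qed

lemma norm_orth_proj_le: "subspace V \<Longrightarrow> norm (orth_proj V x) \<le> norm x"
  and norm_diff_orth_proj_le: "subspace V \<Longrightarrow> norm (x - orth_proj V x) \<le> norm x"
  for V :: "(real^'n) set"
proof -
  assume "subspace V"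
  note pyth = norm_orth_proj_pythagoras[OF this, of x]
  show "norm (orth_proj V x) \<le> norm x"
    by (rule power2_le_imp_le) (use pyth zero_le_power2[of "norm (x - orth_proj V x)"] in simp_all)
  show "norm (x - orth_proj V x) \<le> norm x"
    by (rule power2_le_imp_le) (use pyth zero_le_power2[of "norm (orth_proj V x)"] in simp_all)
qed

lemma proj_matrix_mult: "subspace V \<Longrightarrow> proj_matrix V *v x = orth_proj V x"
  unfolding proj_matrix_def by (simp add: matrix_vector_mul(2)[OF linear_orth_proj])

lemma is_onb_exists:
  fixes V :: "(real^'n) set"
  assumes "subspace V" "dim V = s" shows "\<exists>p. is_onb V s p"
proof -
  obtain B where B: "B \<subseteq> V" "pairwise orthogonal B" "\<And>x. x \<in> B \<Longrightarrow> norm x = 1"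
     "independent B" "card B = dim V" "span B = V"
    using orthonormal_basis_subspace[OF assms(1)] by blast
  have "finite B" using B(4) independent_bound by blast
  then obtain p where p: "bij_betw p {..<s} B"
    using ex_bij_betw_nat_finite[of B] B(5) assms(2) by (auto simp: lessThan_atLeast0)
  have "is_onb V s p" unfolding is_onb_def
  proof (intro conjI allI impI)
    fix i j assume "i < s" "j < s"
    then have "p i \<in> B" "p j \<in> B" "p i = p j \<longleftrightarrow> i = j"
      using p by (auto simp: bij_betw_def inj_on_def)
    then show "p i \<bullet> p j = (if i = j then 1 else 0)"
      using B(2,3) by (auto simp: pairwise_def orthogonal_def norm_eq_1)
  next
    show "span (p ` {..<s}) = V" using p B(6) by (simp add: bij_betw_def)
  qed
  then show ?thesis by blast
qed

context
  fixes V :: "(real^'n) set" and s :: nat and p :: "nat \<Rightarrow> real^'n"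
  assumes onb: "is_onb V s p"
begin

lemma is_onb_subspace: "subspace V"
  using onb subspace_span[of "p ` {..<s}"] by (simp add: is_onb_def)

lemma is_onb_in: "i < s \<Longrightarrow> p i \<in> V"
  using onb span_base[of "p i" "p ` {..<s}"] by (simp add: is_onb_def)

lemma is_onb_combination_in: "(\<Sum>j<s. x j *\<^sub>R p j) \<in> V"
  using is_onb_subspace is_onb_in by (intro subspace_sum subspace_scale) auto

lemma is_onb_inner_combination: "i < s \<Longrightarrow> p i \<bullet> (\<Sum>j<s. x j *\<^sub>R p j) = x i"
proof -
  assume i: "i < s"
  have "p i \<bullet> (\<Sum>j<s. x j *\<^sub>R p j) = (\<Sum>j<s. if j = i then x i else 0)"
    unfolding inner_sum_right using onb i by (intro sum.cong) (auto simp: is_onb_def)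
  then show ?thesis using i by simp
qed

lemma is_onb_orth_proj: "orth_proj V x = (\<Sum>k<s. (p k \<bullet> x) *\<^sub>R p k)"
proof (rule orth_proj_eqI[OF is_onb_subspace is_onb_combination_in])
  fix w assume "w \<in> V"
  then have "w \<in> span (p ` {..<s})" using onb by (simp add: is_onb_def)
  then show "(x - (\<Sum>k<s. (p k \<bullet> x) *\<^sub>R p k)) \<bullet> w = 0"
  proof (rule span_induct)
    show "subspace {w. (x - (\<Sum>k<s. (p k \<bullet> x) *\<^sub>R p k)) \<bullet> w = 0}"
      by (auto simp: subspace_def inner_add_right)
    fix w assume "w \<in> p ` {..<s}"
    then obtain j where "j < s" "w = p j" by auto
    then show "(x - (\<Sum>k<s. (p k \<bullet> x) *\<^sub>R p k)) \<bullet> w = 0"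
      using is_onb_inner_combination[of j "\<lambda>k. p k \<bullet> x"] by (simp add: inner_diff_left inner_diff_right inner_commute)
  qed
qed

lemma is_onb_expansion: "v \<in> V \<Longrightarrow> v = (\<Sum>k<s. (p k \<bullet> v) *\<^sub>R p k)"
  using is_onb_orth_proj orth_proj_id[OF is_onb_subspace] by metis

lemma is_onb_parseval: "v \<in> V \<Longrightarrow> v \<bullet> y = (\<Sum>k<s. (p k \<bullet> v) * (p k \<bullet> y))"
proof -
  assume "v \<in> V"
  then have "v \<bullet> y = (\<Sum>k<s. (p k \<bullet> v) *\<^sub>R p k) \<bullet> y" using is_onb_expansion by metis
  then show ?thesis by (simp add: inner_sum_left)
qed

end

section \<open>The largest principal angle\<close>

text \<open>Eigenvectors of the compression of \<open>P\<^sub>V\<close> to \<open>W\<close>. If the columns of \<open>P\<close> and \<open>Q\<close> are orthonormal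
  bases of \<open>V\<close> and \<open>W\<close>, this operator has the matrix \<open>(P\<^sup>T Q)\<^sup>T (P\<^sup>T Q)\<close> in the basis \<open>Q\<close>, so its
  eigenvalues are the squared cosines of the principal angles.\<close>
definition compression_eigenvector :: "(real^'n) set \<Rightarrow> (real^'n) set \<Rightarrow> real \<Rightarrow> real^'n \<Rightarrow> bool" where
  "compression_eigenvector V W c w \<longleftrightarrow> w \<in> W \<and> w \<noteq> 0 \<and> (\<forall>y\<in>W. orth_proj V w \<bullet> y = c * (w \<bullet> y))"

lemma gram_mult_eq_inner_orth_proj:
  fixes V :: "(real^'n) set"
  assumes p: "is_onb V s p"
  shows "(\<Sum>j<s. (\<Sum>k<s. (p k \<bullet> q i) * (p k \<bullet> q j)) * x j) = q i \<bullet> orth_proj V (\<Sum>j<s. x j *\<^sub>R q j)"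
proof -
  have "(\<Sum>j<s. (\<Sum>k<s. (p k \<bullet> q i) * (p k \<bullet> q j)) * x j)
      = (\<Sum>j<s. \<Sum>k<s. (p k \<bullet> q i) * ((p k \<bullet> q j) * x j))"
    by (simp add: sum_distrib_right mult.assoc)
  also have "\<dots> = (\<Sum>k<s. \<Sum>j<s. (p k \<bullet> q i) * ((p k \<bullet> q j) * x j))"
    by (rule sum.swap)
  also have "\<dots> = (\<Sum>k<s. (p k \<bullet> q i) * (p k \<bullet> (\<Sum>j<s. x j *\<^sub>R q j)))"
    by (simp add: sum_distrib_left inner_sum_right mult.commute)
  also have "\<dots> = q i \<bullet> orth_proj V (\<Sum>j<s. x j *\<^sub>R q j)"
    by (simp add: is_onb_orth_proj[OF p] inner_sum_right mult.commute inner_commute)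
  finally show ?thesis .
qed

lemma is_eigenvalue_sq_gram_iff:
  fixes V W :: "(real^'n) set"
  assumes p: "is_onb V s p" and q: "is_onb W s q"
  shows "is_eigenvalue_sq s (\<lambda>i j. \<Sum>k<s. (p k \<bullet> q i) * (p k \<bullet> q j)) c
    \<longleftrightarrow> (\<exists>w. compression_eigenvector V W c w)"
proof -
  define Q where "Q x = (\<Sum>j<s. x j *\<^sub>R q j)" for x
  have gram: "(\<Sum>j<s. (\<Sum>k<s. (p k \<bullet> q i) * (p k \<bullet> q j)) * x j) = q i \<bullet> orth_proj V (Q x)" for i x
    unfolding Q_def by (rule gram_mult_eq_inner_orth_proj[OF p])
  show ?thesis
  proof
    assume "is_eigenvalue_sq s (\<lambda>i j. \<Sum>k<s. (p k \<bullet> q i) * (p k \<bullet> q j)) c"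
    then obtain x i0 where "i0 < s" "x i0 \<noteq> 0"
      and ev: "\<And>i. i < s \<Longrightarrow> q i \<bullet> orth_proj V (Q x) = c * x i"
      unfolding is_eigenvalue_sq_def gram by blast
    have coord: "i < s \<Longrightarrow> q i \<bullet> Q x = x i" for i
      unfolding Q_def by (rule is_onb_inner_combination[OF q])
    have "orth_proj V (Q x) \<bullet> y = c * (Q x \<bullet> y)" if "y \<in> W" for y
    proof -
      have "orth_proj V (Q x) \<bullet> y = (\<Sum>k<s. (q k \<bullet> y) * (q k \<bullet> orth_proj V (Q x)))"
        unfolding inner_commute[of "orth_proj V (Q x)" y] by (rule is_onb_parseval[OF q that])
      also have "\<dots> = c * (\<Sum>k<s. (q k \<bullet> y) * (q k \<bullet> Q x))"
        by (simp add: ev coord sum_distrib_left mult.left_commute)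
      also have "\<dots> = c * (Q x \<bullet> y)"
        using is_onb_parseval[OF q that, of "Q x"] inner_commute[of y "Q x"] by simp
      finally show ?thesis .
    qed
    moreover have "Q x \<in> W" "Q x \<noteq> 0"
      using is_onb_combination_in[OF q] coord[OF \<open>i0 < s\<close>] \<open>x i0 \<noteq> 0\<close> by (auto simp: Q_def)
    ultimately show "\<exists>w. compression_eigenvector V W c w"
      unfolding compression_eigenvector_def by blast
  next
    assume "\<exists>w. compression_eigenvector V W c w"
    then obtain w where "w \<in> W" "w \<noteq> 0" and ev: "\<And>y. y \<in> W \<Longrightarrow> orth_proj V w \<bullet> y = c * (w \<bullet> y)"
      unfolding compression_eigenvector_def by blast
    define x where "x i = q i \<bullet> w" for i
    have "Q x = w" unfolding Q_def x_def using is_onb_expansion[OF q \<open>w \<in> W\<close>] by simp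
    have "\<exists>i<s. x i \<noteq> 0"
    proof (rule ccontr)
      assume "\<not> (\<exists>i<s. x i \<noteq> 0)"
      then have "Q x = 0" unfolding Q_def by simp
      then show False using \<open>Q x = w\<close> \<open>w \<noteq> 0\<close> by simp
    qed
    moreover have "q i \<bullet> orth_proj V (Q x) = c * x i" if "i < s" for i
      using ev[OF is_onb_in[OF q that]] \<open>Q x = w\<close> by (simp add: x_def inner_commute)
    ultimately show "is_eigenvalue_sq s (\<lambda>i j. \<Sum>k<s. (p k \<bullet> q i) * (p k \<bullet> q j)) c"
      unfolding is_eigenvalue_sq_def gram by blast
  qed
qed

lemma compression_eigenvector_rayleigh:
  assumes "subspace V" "compression_eigenvector V W c w"
  shows "(norm (orth_proj V w))\<^sup>2 = c * (norm w)\<^sup>2"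
  using assms inner_orth_proj_left[OF assms(1), of w w]
  by (simp add: compression_eigenvector_def power2_norm_eq_inner)

text \<open>The compression is symmetric, so eigenvectors for distinct eigenvalues are orthogonal.\<close>
lemma finite_compression_eigenvalues:
  fixes V W :: "(real^'n) set"
  assumes V: "subspace V"
  shows "finite {c. \<exists>w. compression_eigenvector V W c w}"
proof -
  define E where "E = {c. \<exists>w. compression_eigenvector V W c w}"
  define vec where "vec c = (SOME w. compression_eigenvector V W c w)" for c
  have vec: "compression_eigenvector V W c (vec c)" if "c \<in> E" for c
    using that unfolding E_def vec_def by (auto intro: someI_ex)
  have orth: "vec c \<bullet> vec c' = 0" if "c \<in> E" "c' \<in> E" "c \<noteq> c'" for c c'
  proof -
    have "orth_proj V (vec c) \<bullet> vec c' = orth_proj V (vec c') \<bullet> vec c"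
      using inner_orth_proj_left[OF V, of "vec c" "vec c'"] inner_orth_proj_left[OF V, of "vec c'" "vec c"]
      by (simp add: inner_commute)
    then have "(c - c') * (vec c \<bullet> vec c') = 0"
      using vec[OF that(1)] vec[OF that(2)]
      by (simp add: compression_eigenvector_def inner_commute algebra_simps)
    then show ?thesis using that(3) by simp
  qed
  have nonzero: "vec c \<noteq> 0" if "c \<in> E" for c
    using vec[OF that] by (simp add: compression_eigenvector_def)
  have "inj_on vec E"
    by (rule inj_onI) (metis orth nonzero inner_eq_zero_iff)
  moreover have "independent (vec ` E)"
  proof (rule pairwise_orthogonal_independent)
    show "pairwise orthogonal (vec ` E)"
      unfolding pairwise_def orthogonal_def using orth by fastforce
  qed (use nonzero in auto)
  then have "finite (vec ` E)" using independent_bound by blast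
  ultimately show ?thesis unfolding E_def[symmetric] using finite_imageD by blast
qed

lemma linear_coeff_eq_0_if_quadratic_nonneg:
  fixes a b :: real
  assumes "\<And>e. 0 \<le> a * e + b * e\<^sup>2"
  shows "a = 0"
proof (rule ccontr)
  assume "a \<noteq> 0"
  define t where "t = 1 / (\<bar>b\<bar> + 1)"
  have "t > 0" "b * t < 1" unfolding t_def by (auto simp: divide_simps)
  have "0 \<le> a * (- a * t) + b * (- a * t)\<^sup>2" by (rule assms)
  also have "\<dots> = a\<^sup>2 * t * (b * t - 1)" by (simp add: power2_eq_square algebra_simps)
  also have "\<dots> < 0" using \<open>a \<noteq> 0\<close> \<open>t > 0\<close> \<open>b * t < 1\<close> by (intro mult_pos_neg) auto
  finally show False by simp
qed

lemma norm_orth_proj_ge_scaled: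
  fixes V W :: "(real^'n) set"
  assumes V: "subspace V" and W: "subspace W" and "z \<in> W"
    and min: "\<And>w. w \<in> W \<Longrightarrow> norm w = 1 \<Longrightarrow> m \<le> norm (orth_proj V w)"
  shows "m * norm z \<le> norm (orth_proj V z)"
proof (cases "z = 0")
  case True then show ?thesis by (simp add: linear_0[OF linear_orth_proj[OF V]])
next
  case False
  have "m \<le> norm (orth_proj V (z /\<^sub>R norm z))"
    using False \<open>z \<in> W\<close> by (intro min) (auto intro: subspace_scale[OF W])
  also have "\<dots> = norm (orth_proj V z) / norm z"
    by (simp add: linear_scale[OF linear_orth_proj[OF V]] divide_inverse mult.commute)
  finally show ?thesis using False by (simp add: divide_simps)
qed

text \<open>A unit vector minimising \<open>\<parallel>P\<^sub>V w\<parallel>\<close> on \<open>W\<close> is an eigenvector: the first variation of the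
  Rayleigh quotient vanishes in every direction \<open>y \<in> W\<close>.\<close>
lemma compression_eigenvector_if_min:
  fixes V W :: "(real^'n) set"
  assumes V: "subspace V" and W: "subspace W" and "w0 \<in> W" "norm w0 = 1"
    and min: "\<And>w. w \<in> W \<Longrightarrow> norm w = 1 \<Longrightarrow> norm (orth_proj V w0) \<le> norm (orth_proj V w)"
  shows "compression_eigenvector V W ((norm (orth_proj V w0))\<^sup>2) w0"
proof -
  define P where "P = orth_proj V"
  define c0 where "c0 = (norm (P w0))\<^sup>2"
  have P: "linear P" unfolding P_def by (rule linear_orth_proj[OF V])
  have "P w0 \<bullet> y = c0 * (w0 \<bullet> y)" if "y \<in> W" for y
  proof -
    have "0 \<le> (2 * (P w0 \<bullet> P y - c0 * (w0 \<bullet> y))) * e + (P y \<bullet> P y - c0 * (y \<bullet> y)) * e\<^sup>2" for e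
    proof -
      have "w0 + e *\<^sub>R y \<in> W" using \<open>w0 \<in> W\<close> \<open>y \<in> W\<close> W by (simp add: subspace_add subspace_scale)
      then have "(norm (P w0) * norm (w0 + e *\<^sub>R y))\<^sup>2 \<le> (norm (P (w0 + e *\<^sub>R y)))\<^sup>2"
        using norm_orth_proj_ge_scaled[OF V W _ min] unfolding P_def
        by (intro power_mono) auto
      moreover have "(norm (w0 + e *\<^sub>R y))\<^sup>2 = 1 + 2 * e * (w0 \<bullet> y) + e\<^sup>2 * (y \<bullet> y)"
        using norm_eq_1[THEN iffD1, OF \<open>norm w0 = 1\<close>] unfolding power2_norm_eq_inner
        by (simp add: inner_add_left inner_add_right inner_commute power2_eq_square algebra_simps)
      moreover have "(norm (P (w0 + e *\<^sub>R y)))\<^sup>2 = c0 + 2 * e * (P w0 \<bullet> P y) + e\<^sup>2 * (P y \<bullet> P y)"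
        unfolding c0_def power2_norm_eq_inner
        by (simp add: linear_add[OF P] linear_scale[OF P] inner_add_left inner_add_right inner_commute
            power2_eq_square algebra_simps)
      ultimately show ?thesis by (simp add: c0_def power_mult_distrib algebra_simps)
    qed
    then have "2 * (P w0 \<bullet> P y - c0 * (w0 \<bullet> y)) = 0" by (rule linear_coeff_eq_0_if_quadratic_nonneg)
    then show ?thesis using inner_orth_proj_left[OF V, of w0 y] by (simp add: P_def)
  qed
  then show ?thesis
    using \<open>w0 \<in> W\<close> \<open>norm w0 = 1\<close> by (auto simp: compression_eigenvector_def P_def c0_def)
qed

lemma unit_vector_min_norm_orth_proj_exists:
  fixes V W :: "(real^'n) set"
  assumes V: "subspace V" and W: "subspace W" and "W \<noteq> {0}"
  obtains w0 where "w0 \<in> W" "norm w0 = 1"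
    and "\<And>w. w \<in> W \<Longrightarrow> norm w = 1 \<Longrightarrow> norm (orth_proj V w0) \<le> norm (orth_proj V w)"
proof -
  define S where "S = sphere 0 1 \<inter> W"
  have "compact S" unfolding S_def by (intro compact_Int_closed compact_sphere closed_subspace W)
  obtain w1 where "w1 \<in> W" "w1 \<noteq> 0" using \<open>W \<noteq> {0}\<close> subspace_0[OF W] by blast
  then have "w1 /\<^sub>R norm w1 \<in> S" unfolding S_def by (auto intro: subspace_scale[OF W])
  then have "S \<noteq> {}" by blast
  moreover have "continuous_on S (\<lambda>w. norm (orth_proj V w))"
    by (intro continuous_on_norm linear_continuous_on linear_conv_bounded_linear[THEN iffD1]
        linear_orth_proj V)
  ultimately obtain w0 where "w0 \<in> S" "\<And>w. w \<in> S \<Longrightarrow> norm (orth_proj V w0) \<le> norm (orth_proj V w)"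
    using continuous_attains_inf[OF \<open>compact S\<close>] by blast
  then show thesis using that by (auto simp: S_def)
qed

lemma Min_compression_eigenvalues:
  fixes V W :: "(real^'n) set"
  assumes V: "subspace V" and W: "subspace W" and "w0 \<in> W" "norm w0 = 1"
    and min: "\<And>w. w \<in> W \<Longrightarrow> norm w = 1 \<Longrightarrow> norm (orth_proj V w0) \<le> norm (orth_proj V w)"
  shows "Min {c. \<exists>w. compression_eigenvector V W c w} = (norm (orth_proj V w0))\<^sup>2"
proof (rule Min_eqI)
  show "finite {c. \<exists>w. compression_eigenvector V W c w}" by (rule finite_compression_eigenvalues[OF V])
  show "(norm (orth_proj V w0))\<^sup>2 \<in> {c. \<exists>w. compression_eigenvector V W c w}"
    using compression_eigenvector_if_min[OF assms] by blast
next
  fix c assume "c \<in> {c. \<exists>w. compression_eigenvector V W c w}"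
  then obtain w where w: "compression_eigenvector V W c w" by blast
  then have "w \<in> W" "w \<noteq> 0" by (auto simp: compression_eigenvector_def)
  have "(norm (orth_proj V w0))\<^sup>2 * (norm w)\<^sup>2 = (norm (orth_proj V w0) * norm w)\<^sup>2"
    by (simp add: power_mult_distrib)
  also have "\<dots> \<le> (norm (orth_proj V w))\<^sup>2"
    using norm_orth_proj_ge_scaled[OF V W \<open>w \<in> W\<close> min] by (intro power_mono) auto
  also have "\<dots> = c * (norm w)\<^sup>2" by (rule compression_eigenvector_rayleigh[OF V w])
  finally show "(norm (orth_proj V w0))\<^sup>2 \<le> c" using \<open>w \<noteq> 0\<close> by simp
qed

lemma cos_subspace_angle:
  fixes V W :: "(real^'n) set"
  assumes V: "subspace V" and W: "subspace W" and "dim V = s" "dim W = s" "1 \<le> s"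
  obtains w0 where "w0 \<in> W" "norm w0 = 1"
    and "subspace_angle V W = arccos (norm (orth_proj V w0))"
    and "\<And>w. w \<in> W \<Longrightarrow> norm w = 1 \<Longrightarrow> norm (orth_proj V w0) \<le> norm (orth_proj V w)"
proof -
  have "W \<noteq> {0}" using \<open>dim W = s\<close> \<open>1 \<le> s\<close> by auto
  then obtain w0 where "w0 \<in> W" "norm w0 = 1"
    and min: "\<And>w. w \<in> W \<Longrightarrow> norm w = 1 \<Longrightarrow> norm (orth_proj V w0) \<le> norm (orth_proj V w)"
    using unit_vector_min_norm_orth_proj_exists[OF V W] by blast
  define p where "p = (SOME p. is_onb V s p)"
  define q where "q = (SOME q. is_onb W s q)"
  have "is_onb V s p" unfolding p_def by (rule someI_ex[OF is_onb_exists[OF V \<open>dim V = s\<close>]])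
  have "is_onb W s q" unfolding q_def by (rule someI_ex[OF is_onb_exists[OF W \<open>dim W = s\<close>]])
  have "subspace_angle V W
      = arccos (sqrt (Min {c. is_eigenvalue_sq s (\<lambda>i j. \<Sum>k<s. (p k \<bullet> q i) * (p k \<bullet> q j)) c}))"
    unfolding subspace_angle_def Let_def \<open>dim V = s\<close> p_def q_def min_singular_value_def ..
  also have "\<dots> = arccos (sqrt (Min {c. \<exists>w. compression_eigenvector V W c w}))"
    by (simp add: is_eigenvalue_sq_gram_iff[OF \<open>is_onb V s p\<close> \<open>is_onb W s q\<close>])
  also have "\<dots> = arccos (norm (orth_proj V w0))"
    by (simp add: Min_compression_eigenvalues[OF V W \<open>w0 \<in> W\<close> \<open>norm w0 = 1\<close> min])
  finally show thesis by (rule that[OF \<open>w0 \<in> W\<close> \<open>norm w0 = 1\<close> _ min])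
qed

lemma
  fixes V W :: "(real^'n) set"
  assumes V: "subspace V" and W: "subspace W" and "dim V = s" "dim W = s" "1 \<le> s"
  shows subspace_angle_eq_arcsin_sin: "subspace_angle V W = arcsin (sin (subspace_angle V W))"
    and sin_subspace_angle_attained:
      "\<exists>w0\<in>W. norm w0 = 1 \<and> sin (subspace_angle V W) = norm (w0 - orth_proj V w0)"
    and norm_diff_orth_proj_le_sin_subspace_angle:
      "\<And>w. w \<in> W \<Longrightarrow> norm (w - orth_proj V w) \<le> sin (subspace_angle V W) * norm w"
proof -
  obtain w0 where "w0 \<in> W" "norm w0 = 1"
    and angle: "subspace_angle V W = arccos (norm (orth_proj V w0))"
    and min: "\<And>w. w \<in> W \<Longrightarrow> norm w = 1 \<Longrightarrow> norm (orth_proj V w0) \<le> norm (orth_proj V w)"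
    using cos_subspace_angle[OF assms] by blast
  define y where "y = norm (orth_proj V w0)"
  have pyth0: "(norm (w0 - orth_proj V w0))\<^sup>2 = 1 - y\<^sup>2"
    using norm_orth_proj_pythagoras[OF V, of w0] \<open>norm w0 = 1\<close> by (simp add: y_def)
  have "0 \<le> y" "y \<le> 1"
    using norm_orth_proj_le[OF V, of w0] \<open>norm w0 = 1\<close> by (auto simp: y_def)
  have sin: "sin (subspace_angle V W) = norm (w0 - orth_proj V w0)"
    using pyth0 \<open>0 \<le> y\<close> \<open>y \<le> 1\<close> by (simp add: angle y_def[symmetric] sin_arccos real_sqrt_unique)
  show "subspace_angle V W = arcsin (sin (subspace_angle V W))"
    unfolding angle y_def[symmetric]
  proof (rule arcsin_sin[symmetric])
    have "0 \<le> arccos y" using \<open>0 \<le> y\<close> \<open>y \<le> 1\<close> by (intro arccos_lbound) auto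
    then show "- (pi / 2) \<le> arccos y" using pi_gt_zero by linarith
    show "arccos y \<le> pi / 2" using \<open>0 \<le> y\<close> \<open>y \<le> 1\<close> by (rule arccos_le_pi2)
  qed
  show "\<exists>w0\<in>W. norm w0 = 1 \<and> sin (subspace_angle V W) = norm (w0 - orth_proj V w0)"
    using \<open>w0 \<in> W\<close> \<open>norm w0 = 1\<close> sin by blast
  fix w assume "w \<in> W"
  have "(norm (w - orth_proj V w))\<^sup>2 = (norm w)\<^sup>2 - (norm (orth_proj V w))\<^sup>2"
    using norm_orth_proj_pythagoras[OF V, of w] by simp
  also have "\<dots> \<le> (norm w)\<^sup>2 - (y * norm w)\<^sup>2"
    using norm_orth_proj_ge_scaled[OF V W \<open>w \<in> W\<close> min] \<open>0 \<le> y\<close>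
    by (simp add: y_def power_mono)
  also have "\<dots> = (sin (subspace_angle V W) * norm w)\<^sup>2"
    unfolding sin power_mult_distrib pyth0 by (simp add: algebra_simps)
  finally show "norm (w - orth_proj V w) \<le> sin (subspace_angle V W) * norm w"
    by (rule power2_le_imp_le) (simp add: sin)
qed

section \<open>Perturbation of the largest principal angle\<close>

lemma compression_matrix_mult:
  fixes V :: "(real^'n) set"
  assumes "subspace V"
  shows "((mat 1 - proj_matrix V) ** B ** proj_matrix V) *v x
    = B *v orth_proj V x - orth_proj V (B *v orth_proj V x)"
  by (simp add: matrix_vector_mul_assoc[symmetric] matrix_vector_mult_diff_rdistrib
      proj_matrix_mult[OF assms])

lemma norm_compression_le_spectral_norm:
  fixes V :: "(real^'n) set"
  assumes "subspace V" "v \<in> V"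
  shows "norm (B *v v - orth_proj V (B *v v))
    \<le> spectral_norm ((mat 1 - proj_matrix V) ** B ** proj_matrix V) * norm v"
  using norm_matrix_vector_le_spectral_norm[of "(mat 1 - proj_matrix V) ** B ** proj_matrix V" v]
  by (simp add: compression_matrix_mult orth_proj_id assms)

lemma spectral_norm_compression_le:
  fixes V :: "(real^'n) set"
  assumes V: "subspace V" and "0 \<le> K"
    and bound: "\<And>v. v \<in> V \<Longrightarrow> norm (B *v v - orth_proj V (B *v v)) \<le> K * norm v"
  shows "spectral_norm ((mat 1 - proj_matrix V) ** B ** proj_matrix V) \<le> K"
  unfolding spectral_norm_def
proof (rule onorm_le)
  fix x
  have "norm (B *v orth_proj V x - orth_proj V (B *v orth_proj V x)) \<le> K * norm (orth_proj V x)"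
    by (intro bound orth_proj_in V)
  also have "\<dots> \<le> K * norm x" using norm_orth_proj_le[OF V] \<open>0 \<le> K\<close> by (rule mult_left_mono)
  finally show "norm (((mat 1 - proj_matrix V) ** B ** proj_matrix V) *v x) \<le> K * norm x"
    by (simp add: compression_matrix_mult[OF V])
qed

lemma diff_orth_proj_perturbation:
  fixes V :: "(real^'n) set"
  assumes V: "subspace V" and "v \<in> V"
  shows "(mat 1 + h *\<^sub>R B + R) *v v - orth_proj V ((mat 1 + h *\<^sub>R B + R) *v v)
    = h *\<^sub>R (B *v v - orth_proj V (B *v v)) + (R *v v - orth_proj V (R *v v))"
  using orth_proj_id[OF assms]
  by (simp add: matrix_vector_mult_add_rdistrib scaleR_matrix_vector_assoc[symmetric]
      linear_add[OF linear_orth_proj[OF V]] linear_scale[OF linear_orth_proj[OF V]] algebra_simps)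

lemma norm_perturbation_mult:
  fixes B R :: "real^'n^'n"
  assumes "0 \<le> h"
  shows "\<bar>norm ((mat 1 + h *\<^sub>R B + R) *v v) - norm v\<bar> \<le> (h * spectral_norm B + spectral_norm R) * norm v"
proof -
  have "\<bar>norm ((mat 1 + h *\<^sub>R B + R) *v v) - norm v\<bar> \<le> norm (h *\<^sub>R (B *v v) + R *v v)"
    using norm_triangle_ineq3[of "(mat 1 + h *\<^sub>R B + R) *v v" v]
    by (simp add: matrix_vector_mult_add_rdistrib scaleR_matrix_vector_assoc[symmetric])
  also have "\<dots> \<le> h * norm (B *v v) + norm (R *v v)"
    using norm_triangle_ineq[of "h *\<^sub>R (B *v v)" "R *v v"] assms by simp
  also have "\<dots> \<le> h * (spectral_norm B * norm v) + spectral_norm R * norm v"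
    using assms by (intro add_mono mult_left_mono norm_matrix_vector_le_spectral_norm)
  finally show ?thesis by (simp add: algebra_simps)
qed

text \<open>A unit vector \<open>w = M v\<close> realising the angle has \<open>(1 - h \<parallel>B\<parallel> - \<parallel>R\<parallel>) \<parallel>v\<parallel> \<le> 1\<close>, while
  \<open>w - P\<^sub>V w = h (I - P\<^sub>V) B v + (I - P\<^sub>V) R v\<close>.\<close>
lemma sin_subspace_angle_perturbation_le:
  fixes V :: "(real^'n) set" and B R :: "real^'n^'n"
  assumes V: "subspace V" "dim V = s" "1 \<le> s"
    and W: "dim ((*v) (mat 1 + h *\<^sub>R B + R) ` V) = s" and "0 \<le> h"
  shows "sin (subspace_angle V ((*v) (mat 1 + h *\<^sub>R B + R) ` V)) * (1 - h * spectral_norm B - spectral_norm R)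
    \<le> h * spectral_norm ((mat 1 - proj_matrix V) ** B ** proj_matrix V) + spectral_norm R"
    (is "?\<delta> * ?a \<le> h * ?c + ?\<rho>")
proof -
  define M where "M = mat 1 + h *\<^sub>R B + R"
  have "subspace ((*v) M ` V)" by (rule linear_subspace_image) (simp_all add: V(1))
  then obtain w0 where "w0 \<in> (*v) M ` V" "norm w0 = 1" and \<delta>: "?\<delta> = norm (w0 - orth_proj V w0)"
    using sin_subspace_angle_attained[OF V(1) _ V(2) W[folded M_def] V(3)] by (auto simp: M_def)
  then obtain v where "v \<in> V" "w0 = M *v v" by blast
  have "0 \<le> ?c" "0 \<le> ?\<rho>" by (rule spectral_norm_nonneg)+
  show ?thesis
  proof (cases "?a \<le> 0")
    case True
    then have "?\<delta> * ?a \<le> 0" using \<delta> by (simp add: mult_nonneg_nonpos)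
    also have "0 \<le> h * ?c + ?\<rho>" using \<open>0 \<le> h\<close> \<open>0 \<le> ?c\<close> \<open>0 \<le> ?\<rho>\<close> by simp
    finally show ?thesis .
  next
    case False
    have "?\<delta> = norm (h *\<^sub>R (B *v v - orth_proj V (B *v v)) + (R *v v - orth_proj V (R *v v)))"
      using \<delta> diff_orth_proj_perturbation[OF V(1) \<open>v \<in> V\<close>] \<open>w0 = M *v v\<close> by (simp add: M_def)
    also have "\<dots> \<le> h * norm (B *v v - orth_proj V (B *v v)) + norm (R *v v - orth_proj V (R *v v))"
      using norm_triangle_ineq[of "h *\<^sub>R (B *v v - orth_proj V (B *v v))"] \<open>0 \<le> h\<close> by simp
    also have "\<dots> \<le> h * (?c * norm v) + ?\<rho> * norm v"
      using norm_compression_le_spectral_norm[OF V(1) \<open>v \<in> V\<close>, of B] \<open>0 \<le> h\<close>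
        norm_diff_orth_proj_le[OF V(1), of "R *v v"] norm_matrix_vector_le_spectral_norm[of R v]
      by (intro add_mono mult_left_mono) auto
    finally have "?\<delta> * ?a \<le> ((h * ?c + ?\<rho>) * norm v) * ?a"
      using False by (intro mult_right_mono) (auto simp: algebra_simps)
    also have "\<dots> = (h * ?c + ?\<rho>) * (?a * norm v)"
      by (simp only: mult_ac)
    also have "\<dots> \<le> h * ?c + ?\<rho>"
      using mult_left_mono[of "?a * norm v" 1 "h * ?c + ?\<rho>"] norm_perturbation_mult[OF \<open>0 \<le> h\<close>, of B R v]
        \<open>norm w0 = 1\<close> \<open>w0 = M *v v\<close> \<open>0 \<le> h\<close> \<open>0 \<le> ?c\<close> \<open>0 \<le> ?\<rho>\<close>
      by (simp add: M_def algebra_simps abs_le_iff)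
    finally show ?thesis .
  qed
qed

text \<open>Conversely, \<open>\<parallel>M v - P\<^sub>V M v\<parallel> \<le> sin \<angle>(V, M V) \<parallel>M v\<parallel>\<close> controls \<open>h \<parallel>(I - P\<^sub>V) B v\<parallel>\<close> for every
  \<open>v \<in> V\<close>.\<close>
lemma sin_subspace_angle_perturbation_ge:
  fixes V :: "(real^'n) set" and B R :: "real^'n^'n"
  assumes V: "subspace V" "dim V = s" "1 \<le> s"
    and W: "dim ((*v) (mat 1 + h *\<^sub>R B + R) ` V) = s" and "0 \<le> h"
  shows "h * spectral_norm ((mat 1 - proj_matrix V) ** B ** proj_matrix V)
    \<le> sin (subspace_angle V ((*v) (mat 1 + h *\<^sub>R B + R) ` V)) * (1 + h * spectral_norm B + spectral_norm R)
      + spectral_norm R"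
    (is "h * ?c \<le> ?\<delta> * ?a + ?\<rho>")
proof -
  define M where "M = mat 1 + h *\<^sub>R B + R"
  have "subspace ((*v) M ` V)" by (rule linear_subspace_image) (simp_all add: V(1))
  note angle = sin_subspace_angle_attained[OF V(1) this V(2) W[folded M_def] V(3)]
    norm_diff_orth_proj_le_sin_subspace_angle[OF V(1) this V(2) W[folded M_def] V(3)]
  have "0 \<le> ?\<delta>" "0 \<le> ?\<rho>" "0 \<le> spectral_norm B"
    using angle(1) by (auto simp: M_def spectral_norm_nonneg)
  show ?thesis
  proof (cases "h = 0")
    case True
    then show ?thesis using \<open>0 \<le> ?\<rho>\<close> \<open>0 \<le> ?\<delta>\<close> by simp
  next
    case False
    then have "0 < h" using \<open>0 \<le> h\<close> by simp
    have "?c \<le> (?\<delta> * ?a + ?\<rho>) / h"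
    proof (rule spectral_norm_compression_le[OF V(1)])
      show "0 \<le> (?\<delta> * ?a + ?\<rho>) / h"
        using \<open>0 < h\<close> \<open>0 \<le> ?\<rho>\<close> \<open>0 \<le> spectral_norm B\<close> \<open>0 \<le> ?\<delta>\<close> by simp
      fix v assume "v \<in> V"
      define Pw where "Pw = orth_proj V (M *v v)"
      have "h * norm (B *v v - orth_proj V (B *v v))
          = norm ((M *v v - Pw) - (R *v v - orth_proj V (R *v v)))"
        using diff_orth_proj_perturbation[OF V(1) \<open>v \<in> V\<close>] \<open>0 \<le> h\<close> by (simp add: M_def Pw_def)
      also have "\<dots> \<le> ?\<delta> * norm (M *v v) + ?\<rho> * norm v"
        using norm_triangle_ineq4[of "M *v v - Pw" "R *v v - orth_proj V (R *v v)"]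
          angle(2)[of "M *v v"] \<open>v \<in> V\<close>
          norm_diff_orth_proj_le[OF V(1), of "R *v v"] norm_matrix_vector_le_spectral_norm[of R v]
        by (simp add: M_def Pw_def)
      also have "\<dots> \<le> ?\<delta> * (?a * norm v) + ?\<rho> * norm v"
        using norm_perturbation_mult[OF \<open>0 \<le> h\<close>, of B R v] \<open>0 \<le> ?\<delta>\<close>
        by (intro add_right_mono mult_left_mono) (auto simp: M_def algebra_simps abs_le_iff)
      finally show "norm (B *v v - orth_proj V (B *v v)) \<le> (?\<delta> * ?a + ?\<rho>) / h * norm v"
        using \<open>0 < h\<close> by (simp add: field_simps)
    qed
    then show ?thesis using \<open>0 < h\<close> by (simp add: field_simps)
  qed
qed

section \<open>One-sided derivative of the angle\<close>

lemma sin_subspace_angle_self: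
  fixes V :: "(real^'n) set"
  assumes "subspace V" "dim V = s" "1 \<le> s"
  shows "sin (subspace_angle V V) = 0"
  using sin_subspace_angle_attained[OF assms(1,1,2,2,3)] orth_proj_id[OF assms(1)] by auto

lemma spectral_norm_remainder_quotient_tendsto_0:
  fixes M :: "real \<Rightarrow> real^'n^'n"
  assumes "(M has_vector_derivative B) (at_right \<tau>)"
  shows "((\<lambda>t. spectral_norm (M t - M \<tau> - (t - \<tau>) *\<^sub>R B) / (t - \<tau>)) \<longlongrightarrow> 0) (at_right \<tau>)"
proof -
  define C :: real where "C = real CARD('n) * real CARD('n)"
  have "((\<lambda>t. (1 / norm (t - \<tau>)) *\<^sub>R (M t - (M \<tau> + (t - \<tau>) *\<^sub>R B))) \<longlongrightarrow> 0) (at_right \<tau>)"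
    using assms unfolding has_vector_derivative_def has_derivative_within by blast
  then have "((\<lambda>t. norm ((1 / norm (t - \<tau>)) *\<^sub>R (M t - (M \<tau> + (t - \<tau>) *\<^sub>R B)))) \<longlongrightarrow> 0) (at_right \<tau>)"
    by (rule tendsto_norm_zero)
  moreover have "\<forall>\<^sub>F t in at_right \<tau>. norm ((1 / norm (t - \<tau>)) *\<^sub>R (M t - (M \<tau> + (t - \<tau>) *\<^sub>R B)))
      = norm (M t - M \<tau> - (t - \<tau>) *\<^sub>R B) / (t - \<tau>)"
    using eventually_at_right_less by (rule eventually_mono) (simp add: diff_diff_eq)
  ultimately have "((\<lambda>t. norm (M t - M \<tau> - (t - \<tau>) *\<^sub>R B) / (t - \<tau>)) \<longlongrightarrow> 0) (at_right \<tau>)"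
    by (rule tendsto_cong[THEN iffD1, rotated])
  then have upper: "((\<lambda>t. C * (norm (M t - M \<tau> - (t - \<tau>) *\<^sub>R B) / (t - \<tau>))) \<longlongrightarrow> 0) (at_right \<tau>)"
    using tendsto_mult_right_zero by blast
  show ?thesis
  proof (rule tendsto_sandwich[OF _ _ tendsto_const upper])
    show "\<forall>\<^sub>F t in at_right \<tau>. 0 \<le> spectral_norm (M t - M \<tau> - (t - \<tau>) *\<^sub>R B) / (t - \<tau>)"
      using eventually_at_right_less by (rule eventually_mono) (simp add: spectral_norm_nonneg)
    show "\<forall>\<^sub>F t in at_right \<tau>. spectral_norm (M t - M \<tau> - (t - \<tau>) *\<^sub>R B) / (t - \<tau>)
        \<le> C * (norm (M t - M \<tau> - (t - \<tau>) *\<^sub>R B) / (t - \<tau>))"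
      using eventually_at_right_less
      by (rule eventually_mono) (simp add: C_def divide_right_mono spectral_norm_le_norm)
  qed
qed

lemma sin_subspace_angle_quotient_bounds:
  fixes V :: "(real^'n) set" and B M :: "real^'n^'n"
  assumes V: "subspace V" "dim V = s" "1 \<le> s" and W: "dim ((*v) M ` V) = s" and "0 < h"
  defines "\<delta> \<equiv> sin (subspace_angle V ((*v) M ` V))"
    and "c \<equiv> spectral_norm ((mat 1 - proj_matrix V) ** B ** proj_matrix V)"
    and "\<beta> \<equiv> spectral_norm B" and "r \<equiv> spectral_norm (M - mat 1 - h *\<^sub>R B) / h"
  shows "(c - r) / (1 + h * \<beta> + h * r) \<le> \<delta> / h"
    and "0 < 1 - h * \<beta> - h * r \<Longrightarrow> \<delta> / h \<le> (c + r) / (1 - h * \<beta> - h * r)"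
proof -
  have eq: "mat 1 + h *\<^sub>R B + (M - mat 1 - h *\<^sub>R B) = M" by simp
  have \<rho>: "spectral_norm (M - mat 1 - h *\<^sub>R B) = h * r"
    using \<open>0 < h\<close> by (simp add: r_def)
  have "dim ((*v) (mat 1 + h *\<^sub>R B + (M - mat 1 - h *\<^sub>R B)) ` V) = s"
    using W by (simp only: eq)
  note upper = sin_subspace_angle_perturbation_le[OF V this less_imp_le[OF \<open>0 < h\<close>],
      unfolded eq \<rho>, folded \<delta>_def c_def \<beta>_def]
    and lower = sin_subspace_angle_perturbation_ge[OF V this less_imp_le[OF \<open>0 < h\<close>],
      unfolded eq \<rho>, folded \<delta>_def c_def \<beta>_def]
  have "c - r \<le> \<delta> / h * (1 + h * \<beta> + h * r)"
    using lower \<open>0 < h\<close> by (simp add: field_simps)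
  moreover have "0 < 1 + h * \<beta> + h * r"
    using \<open>0 < h\<close> by (simp add: \<beta>_def r_def add_pos_nonneg spectral_norm_nonneg)
  ultimately show "(c - r) / (1 + h * \<beta> + h * r) \<le> \<delta> / h"
    by (simp add: pos_divide_le_eq)
  assume "0 < 1 - h * \<beta> - h * r"
  moreover have "\<delta> / h * (1 - h * \<beta> - h * r) \<le> c + r"
    using upper \<open>0 < h\<close> by (simp add: field_simps)
  ultimately show "\<delta> / h \<le> (c + r) / (1 - h * \<beta> - h * r)"
    by (simp add: pos_le_divide_eq)
qed

lemma sin_subspace_angle_image_right_derivative:
  fixes V :: "(real^'n) set" and M :: "real \<Rightarrow> real^'n^'n"
  assumes V: "subspace V" "dim V = s" "1 \<le> s"
    and M: "(M has_vector_derivative B) (at_right \<tau>)" "M \<tau> = mat 1"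
    and dim: "\<forall>\<^sub>F t in at_right \<tau>. dim ((*v) (M t) ` V) = s"
  shows "((\<lambda>t. sin (subspace_angle V ((*v) (M t) ` V))) has_real_derivative
      spectral_norm ((mat 1 - proj_matrix V) ** B ** proj_matrix V)) (at_right \<tau>)"
proof -
  define \<delta> where "\<delta> t = sin (subspace_angle V ((*v) (M t) ` V))" for t
  define c where "c = spectral_norm ((mat 1 - proj_matrix V) ** B ** proj_matrix V)"
  define \<beta> where "\<beta> = spectral_norm B"
  define r where "r t = spectral_norm (M t - mat 1 - (t - \<tau>) *\<^sub>R B) / (t - \<tau>)" for t
  have "\<delta> \<tau> = 0"
    unfolding \<delta>_def \<open>M \<tau> = mat 1\<close> using sin_subspace_angle_self[OF V] by simp
  have r: "(r \<longlongrightarrow> 0) (at_right \<tau>)"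
    using spectral_norm_remainder_quotient_tendsto_0[OF M(1)] unfolding r_def \<open>M \<tau> = mat 1\<close> .
  have h: "((\<lambda>t. t - \<tau>) \<longlongrightarrow> 0) (at_right \<tau>)"
    by (rule LIM_zero) (rule tendsto_ident_at)
  define L where "L t = (c - r t) / (1 + (t - \<tau>) * \<beta> + (t - \<tau>) * r t)" for t
  define U where "U t = (c + r t) / (1 - (t - \<tau>) * \<beta> - (t - \<tau>) * r t)" for t
  have "(L \<longlongrightarrow> (c - 0) / (1 + 0 * \<beta> + 0 * 0)) (at_right \<tau>)"
    unfolding L_def by (intro tendsto_intros h r) simp
  then have L: "(L \<longlongrightarrow> c) (at_right \<tau>)" by simp
  have "(U \<longlongrightarrow> (c + 0) / (1 - 0 * \<beta> - 0 * 0)) (at_right \<tau>)"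
    unfolding U_def by (intro tendsto_intros h r) simp
  then have U: "(U \<longlongrightarrow> c) (at_right \<tau>)" by simp
  have "((\<lambda>t. 1 - (t - \<tau>) * \<beta> - (t - \<tau>) * r t) \<longlongrightarrow> 1 - 0 * \<beta> - 0 * 0) (at_right \<tau>)"
    by (intro tendsto_intros h r)
  then have "\<forall>\<^sub>F t in at_right \<tau>. 0 < 1 - (t - \<tau>) * \<beta> - (t - \<tau>) * r t"
    by (intro order_tendstoD(1)) auto
  then have bounds: "\<forall>\<^sub>F t in at_right \<tau>. L t \<le> (\<delta> t - \<delta> \<tau>) / (t - \<tau>) \<and> (\<delta> t - \<delta> \<tau>) / (t - \<tau>) \<le> U t"
    using eventually_at_right_less dim
  proof eventually_elim
    case (elim t)
    then have "0 < t - \<tau>" by simp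
    note quotient = sin_subspace_angle_quotient_bounds[OF V elim(3) this, of B, folded \<delta>_def c_def \<beta>_def r_def]
    show ?case
      using quotient(1) quotient(2)[OF elim(1)] by (simp add: \<open>\<delta> \<tau> = 0\<close> L_def U_def)
  qed
  have "((\<lambda>t. (\<delta> t - \<delta> \<tau>) / (t - \<tau>)) \<longlongrightarrow> c) (at_right \<tau>)"
    by (rule tendsto_sandwich[OF _ _ L U]) (use bounds in \<open>auto elim: eventually_mono\<close>)
  then show ?thesis
    unfolding has_field_derivative_iff \<delta>_def c_def .
qed

lemma subspace_angle_image_right_derivative:
  fixes V :: "(real^'n) set" and M :: "real \<Rightarrow> real^'n^'n"
  assumes V: "subspace V" "dim V = s" "1 \<le> s"
    and M: "(M has_vector_derivative B) (at_right \<tau>)" "M \<tau> = mat 1"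
    and dim: "\<forall>\<^sub>F t in at_right \<tau>. dim ((*v) (M t) ` V) = s"
  shows "((\<lambda>t. subspace_angle V ((*v) (M t) ` V)) has_real_derivative
      spectral_norm ((mat 1 - proj_matrix V) ** B ** proj_matrix V)) (at_right \<tau>)"
proof -
  define \<theta> where "\<theta> t = subspace_angle V ((*v) (M t) ` V)" for t
  have "\<theta> \<tau> = subspace_angle V V" by (simp add: \<theta>_def \<open>M \<tau> = mat 1\<close>)
  have "sin (\<theta> \<tau>) = 0" using sin_subspace_angle_self[OF V] by (simp add: \<open>\<theta> \<tau> = subspace_angle V V\<close>)
  have "((\<lambda>t. arcsin (sin (\<theta> t))) has_real_derivative
      inverse (sqrt (1 - (sin (\<theta> \<tau>))\<^sup>2)) * spectral_norm ((mat 1 - proj_matrix V) ** B ** proj_matrix V))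
      (at_right \<tau>)"
    using sin_subspace_angle_image_right_derivative[OF V M dim] \<open>sin (\<theta> \<tau>) = 0\<close>
    unfolding \<theta>_def by (intro DERIV_chain2[OF DERIV_arcsin]) auto
  moreover have "\<forall>\<^sub>F t in at_right \<tau>. arcsin (sin (\<theta> t)) = \<theta> t"
    using dim
  proof (rule eventually_mono)
    fix t assume "dim ((*v) (M t) ` V) = s"
    moreover have "subspace ((*v) (M t) ` V)" by (rule linear_subspace_image) (simp_all add: V(1))
    ultimately show "arcsin (sin (\<theta> t)) = \<theta> t"
      unfolding \<theta>_def using subspace_angle_eq_arcsin_sin[OF V(1) _ V(2) _ V(3)] by metis
  qed
  moreover have "arcsin (sin (\<theta> \<tau>)) = \<theta> \<tau>"
    using subspace_angle_eq_arcsin_sin[OF V(1) V(1) V(2) V(2) V(3)] \<open>\<theta> \<tau> = subspace_angle V V\<close> by simp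
  ultimately show ?thesis
    using \<open>sin (\<theta> \<tau>) = 0\<close> by (simp add: has_field_derivative_cong_eventually \<theta>_def)
qed

theorem corollary3p7:
  fixes A :: "real \<Rightarrow> real^'n^'n"
    and \<Phi> :: "real \<Rightarrow> real \<Rightarrow> real^'n^'n"
    and T :: ereal
    and s :: nat
    and V0 :: "(real^'n) set"
    and \<tau> :: real
  assumes A_cont: "continuous_on (time_dom T) A"
    and \<Phi>_ode: "\<forall>\<sigma>\<in>time_dom T. \<forall>t\<in>time_dom T.
                 ((\<lambda>t. \<Phi> t \<sigma>) has_vector_derivative (A t ** \<Phi> t \<sigma>)) (at t within time_dom T)"
    and \<Phi>_init: "\<forall>\<sigma>\<in>time_dom T. \<Phi> \<sigma> \<sigma> = mat 1"
    and s_pos: "1 \<le> s"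
    and V0: "V0 \<in> grassmannian s"
    and \<tau>: "\<tau> \<in> time_dom T"
  shows "((\<lambda>t. subspace_angle ((\<lambda>v. \<Phi> \<tau> 0 *v v) ` V0) ((\<lambda>v. \<Phi> t 0 *v v) ` V0))
           has_real_derivative
           spectral_norm ((mat 1 - proj_matrix ((\<lambda>v. \<Phi> \<tau> 0 *v v) ` V0)) ** A \<tau>
                          ** proj_matrix ((\<lambda>v. \<Phi> \<tau> 0 *v v) ` V0)))
         (at_right \<tau>)"
proof -
  have "0 \<in> time_dom T" using atLeastAtMost_subset_time_dom[OF \<tau>] \<tau> by (auto simp: time_dom_def)
  note fundamental = \<Phi>_ode[rule_format, OF \<open>0 \<in> time_dom T\<close>] \<Phi>_init[rule_format, OF \<open>0 \<in> time_dom T\<close>]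
  obtain M where M: "M \<tau> = mat 1" "(M has_vector_derivative A \<tau>) (at_right \<tau>)"
    and image: "\<And>t X. (*v) (M t) ` (*v) (\<Phi> \<tau> 0) ` X = (*v) (\<Phi> t 0) ` X"
    by (rule fundamental_matrix_relative[where U = "\<lambda>t. \<Phi> t 0", OF A_cont _ _ \<tau>]) (use fundamental in auto)
  have "subspace V0" "dim V0 = s" using V0 by (auto simp: grassmannian_def)
  have dim: "dim ((*v) (\<Phi> t 0) ` V0) = s" if "t \<in> time_dom T" for t
  proof -
    have "inj ((*v) (\<Phi> t 0))"
      by (rule fundamental_matrix_injective[where U = "\<lambda>t. \<Phi> t 0", OF A_cont _ _ that]) (use fundamental in auto)
    then show ?thesis using dim_image_eq[of "(*v) (\<Phi> t 0)" V0] \<open>dim V0 = s\<close> by (simp add: inj_on_subset)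
  qed
  define V where "V = (*v) (\<Phi> \<tau> 0) ` V0"
  have "subspace V" "dim V = s"
    using dim[OF \<tau>] linear_subspace_image[OF _ \<open>subspace V0\<close>] by (auto simp: V_def)
  moreover have "\<forall>\<^sub>F t in at_right \<tau>. dim ((*v) (M t) ` V) = s"
    using eventually_at_right_time_dom[OF \<tau>] by (rule eventually_mono) (simp add: V_def image dim)
  ultimately have "((\<lambda>t. subspace_angle V ((*v) (M t) ` V)) has_real_derivative
      spectral_norm ((mat 1 - proj_matrix V) ** A \<tau> ** proj_matrix V)) (at_right \<tau>)"
    using subspace_angle_image_right_derivative[OF _ _ s_pos M(2,1)] by blast
  then show ?thesis unfolding V_def image .
qed

end
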